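(* Let $M$ be a smooth manifold, and let $\mathfrak{a}$ be a Łojasiewicz ideal in $\mathcal{E}(M)$. Then the following are equivalent: (1) $\mathfrak{a}$ has the zero property; (2) $\mathfrak{a}$ is closed, convex, and radical.
   Context: $\mathcal{E}(M)$ is the algebra of real-valued $C^\infty$ functions on the smooth manifold $M$, with the $C^\infty$ compact-open topology (uniform convergence on compact sets of all derivatives); "closed" refers to this topology. Fix a distance $d$ on $M$ inducing its topology and locally equivalent to the Euclidean distance in charts; $d(x,X)=\inf_{y\in X}d(x,y)$, with the convention $d(x,\varnothing)=1$. For an ideal $\mathfrak{a}\subset\mathcal{E}(M)$, $\mathcal{Z}(\mathfrak{a})$ is its common zero set in $M$, and $\mathcal{I}(X)$ is the ideal of all $g\in\mathcal{E}(M)$ vanishing on $X\subset M$. An ideal $\mathfrak{a}\subset\mathcal{E}(M)$: - has the zero property if $\mathfrak{a}=\mathcal{I}(\mathcal{Z}(\mathfrak{a}))$; - is convex if every $g\in\mathcal{E}(M)$ satisfying $|g|\le f$ on $M$ for some $f\in\mathfrak{a}$ belongs to $\mathfrak{a}$; - is radical if $g^k\in\mathfrak{a}$ with $k\ge 1$ implies $g\in\mathfrak{a}$; - is a Łojasiewicz ideal if (i) it is generated by finitely many smooth functions, and (ii) it contains an element $f$ such that for every compact $K\subset M$ there are a constant $c>0$ and a positive integer $m$ with $|f(x)|\ge c\,d(x,\mathcal{Z}(\mathfrak{a}))^m$ for all $x$ in an open neighborhood of $K$. *)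

theory Defs
  imports "HOL-Analysis.Analysis" "HOL-Algebra.Ideal"
begin

text \<open>
  A manifold is the whole of a Hausdorff second countable type \<open>'a\<close> together with a smooth
  atlas, not necessarily maximal.  A chart is a pair \<open>(U, \<phi>)\<close>; only the values of \<open>\<phi>\<close> on
  \<open>U\<close> matter.  The model space \<open>'e\<close> is a finite-dimensional real inner product space,
  i.e. some Euclidean space; class \<open>euclidean_space\<close> is not used because it excludes
  dimension 0.
\<close>

type_synonym ('a, 'e) chart = "'a set \<times> ('a \<Rightarrow> 'e)"

text \<open>
  For finite-dimensional domains and open \<open>S\<close> this is the usual class $C^k$: all iterated
  directional derivatives up to order \<open>k\<close> exist and are continuous.
\<close>

primrec Ck_on :: "nat \<Rightarrow> ('e::real_normed_vector \<Rightarrow> 'f::real_normed_vector) \<Rightarrow> 'e set \<Rightarrow> bool" where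
  "Ck_on 0 f S \<longleftrightarrow> continuous_on S f"
| "Ck_on (Suc k) f S \<longleftrightarrow> (\<forall>x\<in>S. f differentiable (at x)) \<and>
     (\<forall>v. Ck_on k (\<lambda>x. frechet_derivative f (at x) v) S)"

definition Cinf_on :: "('e::real_normed_vector \<Rightarrow> 'f::real_normed_vector) \<Rightarrow> 'e set \<Rightarrow> bool" where
  "Cinf_on f S \<longleftrightarrow> (\<forall>k. Ck_on k f S)"

locale smooth_manifold =
  fixes A :: "('a::{t2_space, second_countable_topology}, 'e::real_inner) chart set"
  assumes finite_dim: "\<exists>B::'e set. finite B \<and> span B = UNIV"
    and chart_open: "(U, \<phi>) \<in> A \<Longrightarrow> open U"
    and chart_image_open: "(U, \<phi>) \<in> A \<Longrightarrow> open (\<phi> ` U)"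
    and chart_homeomorphism: "(U, \<phi>) \<in> A \<Longrightarrow> homeomorphism U (\<phi> ` U) \<phi> (inv_into U \<phi>)"
    and charts_cover: "(\<Union>(U, \<phi>)\<in>A. U) = UNIV"
    and transition_smooth:
      "(U, \<phi>) \<in> A \<Longrightarrow> (V, \<psi>) \<in> A \<Longrightarrow> Cinf_on (\<psi> \<circ> inv_into U \<phi>) (\<phi> ` (U \<inter> V))"

definition smooth_functions ::
    "('a::{t2_space, second_countable_topology}, 'e::real_inner) chart set \<Rightarrow> ('a \<Rightarrow> real) set" where
  "smooth_functions A = {f. \<forall>(U, \<phi>)\<in>A. Cinf_on (f \<circ> inv_into U \<phi>) (\<phi> ` U)}"

definition smooth_ring ::
    "('a::{t2_space, second_countable_topology}, 'e::real_inner) chart set \<Rightarrow> ('a \<Rightarrow> real) ring" where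
  "smooth_ring A = \<lparr>carrier = smooth_functions A,
     monoid.mult = (\<lambda>f g x. f x * g x), one = (\<lambda>x. 1),
     zero = (\<lambda>x. 0), add = (\<lambda>f g x. f x + g x)\<rparr>"

primrec iterated_deriv :: "'e::real_normed_vector list \<Rightarrow> ('e \<Rightarrow> real) \<Rightarrow> 'e \<Rightarrow> real" where
  "iterated_deriv [] f = f"
| "iterated_deriv (v # vs) f = (\<lambda>x. frechet_derivative (iterated_deriv vs f) (at x) v)"

text \<open>
  The $C^\infty$ compact-open topology: the open balls, with centre \<open>f\<close> and radius
  \<open>\<epsilon>\<close>, of the seminorms given by the supremum over a compact subset \<open>K\<close> of a chart domain of
  one iterated directional derivative, taken in that chart, form a subbase.  The strict
  pointwise bound on \<open>K\<close> amounts to a strict bound on the supremum, by compactness.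
\<close>

definition smooth_topology ::
    "('a::{t2_space, second_countable_topology}, 'e::real_inner) chart set \<Rightarrow> ('a \<Rightarrow> real) topology" where
  "smooth_topology A = topology_generated_by
     {{g \<in> smooth_functions A. \<forall>x\<in>K.
         \<bar>iterated_deriv vs ((\<lambda>y. g y - f y) \<circ> inv_into U \<phi>) (\<phi> x)\<bar> < \<epsilon>} | f U \<phi> K vs \<epsilon>.
       f \<in> smooth_functions A \<and> (U, \<phi>) \<in> A \<and> compact K \<and> K \<subseteq> U \<and> \<epsilon> > 0}"

definition manifold_distance ::
    "('a::{t2_space, second_countable_topology}, 'e::real_inner) chart set \<Rightarrow>
     ('a \<Rightarrow> 'a \<Rightarrow> real) \<Rightarrow> bool" where
  "manifold_distance A d \<longleftrightarrow>
     Metric_space UNIV d \<and> Metric_space.mtopology UNIV d = euclidean \<and>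
     (\<forall>(U, \<phi>)\<in>A. \<forall>x\<in>U. \<exists>W c C. open W \<and> x \<in> W \<and> W \<subseteq> U \<and> 0 < c \<and> 0 < C \<and>
        (\<forall>y\<in>W. \<forall>z\<in>W. c * dist (\<phi> y) (\<phi> z) \<le> d y z \<and> d y z \<le> C * dist (\<phi> y) (\<phi> z)))"

definition dist_to_set :: "('a \<Rightarrow> 'a \<Rightarrow> real) \<Rightarrow> 'a \<Rightarrow> 'a set \<Rightarrow> real" where
  "dist_to_set d x X = (if X = {} then 1 else (INF y\<in>X. d x y))"

definition zero_set :: "('a \<Rightarrow> real) set \<Rightarrow> 'a set" where
  "zero_set \<aa> = {x. \<forall>f\<in>\<aa>. f x = 0}"

definition vanishing_ideal ::
    "('a::{t2_space, second_countable_topology}, 'e::real_inner) chart set \<Rightarrow> 'a set \<Rightarrow>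
     ('a \<Rightarrow> real) set" where
  "vanishing_ideal A X = {g \<in> smooth_functions A. \<forall>x\<in>X. g x = 0}"

definition zero_property ::
    "('a::{t2_space, second_countable_topology}, 'e::real_inner) chart set \<Rightarrow>
     ('a \<Rightarrow> real) set \<Rightarrow> bool" where
  "zero_property A \<aa> \<longleftrightarrow> \<aa> = vanishing_ideal A (zero_set \<aa>)"

definition convex_ideal ::
    "('a::{t2_space, second_countable_topology}, 'e::real_inner) chart set \<Rightarrow>
     ('a \<Rightarrow> real) set \<Rightarrow> bool" where
  "convex_ideal A \<aa> \<longleftrightarrow>
     (\<forall>g\<in>smooth_functions A. (\<exists>f\<in>\<aa>. \<forall>x. \<bar>g x\<bar> \<le> f x) \<longrightarrow> g \<in> \<aa>)"

definition radical_ideal ::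
    "('a::{t2_space, second_countable_topology}, 'e::real_inner) chart set \<Rightarrow>
     ('a \<Rightarrow> real) set \<Rightarrow> bool" where
  "radical_ideal A \<aa> \<longleftrightarrow>
     (\<forall>g\<in>smooth_functions A. \<forall>k\<ge>1. (\<lambda>x. g x ^ k) \<in> \<aa> \<longrightarrow> g \<in> \<aa>)"

definition lojasiewicz_ideal ::
    "('a::{t2_space, second_countable_topology}, 'e::real_inner) chart set \<Rightarrow>
     ('a \<Rightarrow> 'a \<Rightarrow> real) \<Rightarrow> ('a \<Rightarrow> real) set \<Rightarrow> bool" where
  "lojasiewicz_ideal A d \<aa> \<longleftrightarrow>
     ideal \<aa> (smooth_ring A) \<and>
     (\<exists>F. finite F \<and> F \<subseteq> smooth_functions A \<and> \<aa> = genideal (smooth_ring A) F) \<and>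
     (\<exists>f\<in>\<aa>. \<forall>K. compact K \<longrightarrow>
        (\<exists>c>0. \<exists>m\<ge>1. \<exists>W. open W \<and> K \<subseteq> W \<and>
           (\<forall>x\<in>W. \<bar>f x\<bar> \<ge> c * dist_to_set d x (zero_set \<aa>) ^ m)))"

end

theory Submission
  imports Defs
begin

text \<open>
  The ideal of all smooth functions vanishing on a set is closed because evaluation at a point is
  continuous, and it is visibly convex and radical.  This is one direction.

  For the other direction, let \<open>g\<close> vanish on the common zero set \<open>Z\<close> of the ideal, and first suppose
  that \<open>g\<close> has compact support.  A smooth function is locally Lipschitz, so \<open>\<bar>g\<bar>\<close> is at most a constant
  times the distance to \<open>Z\<close> on its support (\<open>smooth_le_distance\<close>).  The ideal contains some \<open>f\<close> with
  \<open>\<bar>f\<bar>\<close> at least a constant times the \<open>m\<close>-th power of this distance on the support.  Together,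
  $g^{2m} \le B^2 f^2$ everywhere.  As the right side lies in the ideal, convexity puts $g^{2m}$ into
  it, and radicality puts \<open>g\<close> into it (\<open>compactly_supported_mem_lojasiewicz_ideal\<close>).

  A general \<open>g\<close> is reduced to this case by closedness.  If \<open>g\<close> were outside the ideal, an open set
  around \<open>g\<close> would miss the ideal.  For some compact set \<open>K\<close>, this open set
  contains every smooth function that agrees with \<open>g\<close> near \<open>K\<close> (\<open>smooth_topology_open_germ\<close>), hence
  the product of \<open>g\<close> with a compactly supported smooth function that is 1 near \<open>K\<close>
  (\<open>smooth_cutoff\<close>).  But this product lies in the ideal by the first case.

  The cutoff functions need $e^{-1/t}$ and the closure of the $C^k$ functions under the usual
  operations; all of the latter follow by induction on \<open>k\<close> from the formula for the derivative.
\<close>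

section \<open>Calculus of $C^k$ functions\<close>

text \<open>
  Valid also where no derivative exists: both sides then choose from the same empty set of
  candidates.  Hence iterated derivatives are determined by germs for arbitrary functions, without
  any differentiability to keep track of.
\<close>
lemma frechet_derivative_cong_open:
  assumes "open S" "x \<in> S" "\<And>y. y \<in> S \<Longrightarrow> f y = g y"
  shows "frechet_derivative f (at x) = frechet_derivative g (at x)"
proof -
  have "(f has_derivative D) (at x) \<longleftrightarrow> (g has_derivative D) (at x)" for D
    using assms by (metis has_derivative_transform_within_open)
  then show ?thesis
    by (simp add: frechet_derivative_def)
qed

lemma iterated_deriv_cong_open:
  assumes "open S" "\<And>y. y \<in> S \<Longrightarrow> f y = g y" "x \<in> S"
  shows "iterated_deriv vs f x = iterated_deriv vs g x"
  using assms(3)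
proof (induction vs arbitrary: x)
  case (Cons v vs)
  then show ?case
    using frechet_derivative_cong_open[OF assms(1), of x "iterated_deriv vs f" "iterated_deriv vs g"]
    by simp
qed (use assms in simp)

lemma Ck_on_cong:
  assumes "open S" "\<And>x. x \<in> S \<Longrightarrow> f x = g x" "Ck_on k f S"
  shows "Ck_on k g S"
  using assms(2,3)
proof (induction k arbitrary: f g)
  case 0
  then show ?case by (simp cong: continuous_on_cong)
next
  case (Suc k)
  have "g differentiable at x" if "x \<in> S" for x
  proof -
    have "f differentiable at x"
      using Suc.prems(2) that by simp
    then obtain D where "(f has_derivative D) (at x)"
      unfolding differentiable_def ..
    then have "(g has_derivative D) (at x)"
      by (rule has_derivative_transform_within_open[OF _ assms(1) that Suc.prems(1)])
    then show ?thesis by (auto simp: differentiable_def)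
  qed
  moreover have "Ck_on k (\<lambda>x. frechet_derivative g (at x) v) S" for v
  proof (rule Suc.IH)
    show "frechet_derivative f (at x) v = frechet_derivative g (at x) v" if "x \<in> S" for x
      using frechet_derivative_cong_open[OF assms(1) that Suc.prems(1)] by simp
    show "Ck_on k (\<lambda>x. frechet_derivative f (at x) v) S"
      using Suc.prems(2) by simp
  qed
  ultimately show ?case by simp
qed

lemma Ck_on_local:
  assumes "\<And>x. x \<in> S \<Longrightarrow> \<exists>T. open T \<and> x \<in> T \<and> Ck_on k f T"
  shows "Ck_on k f S"
  using assms
proof (induction k arbitrary: f)
  case 0
  have "isCont f x" if x: "x \<in> S" for x
  proof -
    obtain T where "open T" "x \<in> T" "continuous_on T f"
      using 0[OF x] by auto
    then show ?thesis by (simp add: continuous_on_eq_continuous_at)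
  qed
  then show ?case by (simp add: continuous_at_imp_continuous_on)
next
  case (Suc k)
  have "Ck_on k (\<lambda>x. frechet_derivative f (at x) v) S" for v
  proof (rule Suc.IH)
    fix x assume "x \<in> S"
    from Suc.prems[OF this] show "\<exists>T. open T \<and> x \<in> T \<and> Ck_on k (\<lambda>x. frechet_derivative f (at x) v) T"
      by auto
  qed
  moreover have "f differentiable at x" if "x \<in> S" for x
    using Suc.prems[OF that] by auto
  ultimately show ?case by simp
qed

lemma Ck_on_SucI:
  assumes "open S" "\<And>x. x \<in> S \<Longrightarrow> (f has_derivative f' x) (at x)"
    and "\<And>v. Ck_on k (\<lambda>x. f' x v) S"
  shows "Ck_on (Suc k) f S"
proof -
  have "Ck_on k (\<lambda>x. frechet_derivative f (at x) v) S" for v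
    by (rule Ck_on_cong[OF assms(1) _ assms(3)[of v]])
      (simp add: frechet_derivative_at[OF assms(2), symmetric])
  with assms show ?thesis by (auto simp: differentiable_def)
qed

lemma Ck_on_has_derivative:
  "Ck_on (Suc k) f S \<Longrightarrow> x \<in> S \<Longrightarrow> (f has_derivative frechet_derivative f (at x)) (at x)"
  by (simp add: frechet_derivative_works)

text \<open>
  Differentiability gives continuity; this starts the induction.
\<close>
lemma Ck_on_lower: "Ck_on (Suc k) f S \<Longrightarrow> Ck_on k f S"
proof (induction k arbitrary: f)
  case 0
  then have "isCont f x" if "x \<in> S" for x
    using that unfolding Ck_on.simps by (blast intro: differentiable_imp_continuous_within)
  then show ?case
    by (simp add: continuous_at_imp_continuous_on)
next
  case (Suc k)
  have "Ck_on k (\<lambda>x. frechet_derivative f (at x) v) S" for v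
    using Suc.prems by (intro Suc.IH) simp
  with Suc.prems show ?case by simp
qed

lemma Ck_on_const:
  fixes c :: "'f::real_normed_vector"
  shows "open S \<Longrightarrow> Ck_on k (\<lambda>x. c) S"
proof (induction k arbitrary: c)
  case (Suc k)
  show ?case
  proof (rule Ck_on_SucI[where f' = "\<lambda>x v. 0"])
    show "Ck_on k (\<lambda>x. 0 :: 'f) S" by (rule Suc.IH[OF Suc.prems])
  qed (use Suc.prems in simp_all)
qed simp

lemma Ck_on_add:
  "open S \<Longrightarrow> Ck_on k f S \<Longrightarrow> Ck_on k g S \<Longrightarrow> Ck_on k (\<lambda>x. f x + g x) S"
proof (induction k arbitrary: f g)
  case 0
  then show ?case by (auto intro: continuous_intros)
next
  case (Suc k)
  show ?case
  proof (rule Ck_on_SucI[OF Suc.prems(1)])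
    fix x assume "x \<in> S"
    then show "((\<lambda>x. f x + g x) has_derivative
        (\<lambda>v. frechet_derivative f (at x) v + frechet_derivative g (at x) v)) (at x)"
      by (intro has_derivative_add Ck_on_has_derivative[OF Suc.prems(2)]
          Ck_on_has_derivative[OF Suc.prems(3)])
  next
    fix v
    show "Ck_on k (\<lambda>x. frechet_derivative f (at x) v + frechet_derivative g (at x) v) S"
      using Suc.prems by (intro Suc.IH) simp_all
  qed
qed

text \<open>
  The product rule expresses the derivative by products of functions of class $C^k$, so induction on
  \<open>k\<close> applies.  Bilinear maps cover both the multiplication of functions and the inner product,
  which gives the square of the distance to a point.
\<close>
lemma (in bounded_bilinear) Ck_on:
  "open S \<Longrightarrow> Ck_on k f S \<Longrightarrow> Ck_on k g S \<Longrightarrow> Ck_on k (\<lambda>x. prod (f x) (g x)) S"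
proof (induction k arbitrary: f g)
  case 0
  then show ?case by (auto intro: continuous_on)
next
  case (Suc k)
  show ?case
  proof (rule Ck_on_SucI[OF Suc.prems(1) FDERIV])
    fix v
    show "Ck_on k (\<lambda>x. prod (f x) (frechet_derivative g (at x) v)
                    + prod (frechet_derivative f (at x) v) (g x)) S"
      using Suc.prems Ck_on_lower[OF Suc.prems(2)] Ck_on_lower[OF Suc.prems(3)]
      by (intro Ck_on_add Suc.IH) simp_all
  qed (rule Ck_on_has_derivative[OF Suc.prems(2)], assumption,
      rule Ck_on_has_derivative[OF Suc.prems(3)], assumption)
qed

lemmas Ck_on_mult = bounded_bilinear.Ck_on[OF bounded_bilinear_mult]
lemmas Ck_on_inner = bounded_bilinear.Ck_on[OF bounded_bilinear_inner]

lemma Ck_on_diff: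
  fixes f g :: "'e::real_normed_vector \<Rightarrow> real"
  assumes "open S" "Ck_on k f S" "Ck_on k g S"
  shows "Ck_on k (\<lambda>x. f x - g x) S"
  using Ck_on_add[OF assms(1,2) Ck_on_mult[OF assms(1) Ck_on_const[OF assms(1), of k "-1"] assms(3)]]
  by simp

text \<open>
  The derivative $-f^{-1}\,Df\,f^{-1}$ contains $f^{-1}$ itself, of class $C^k$ by the induction
  hypothesis, which makes the induction close up with the product rule.
\<close>
lemma Ck_on_inverse:
  fixes f :: "'e::real_normed_vector \<Rightarrow> real"
  assumes "open S" "\<And>x. x \<in> S \<Longrightarrow> f x \<noteq> 0" "Ck_on k f S"
  shows "Ck_on k (\<lambda>x. inverse (f x)) S"
  using assms(3)
proof (induction k)
  case 0
  then show ?case using assms(2) by (auto intro: continuous_intros)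
next
  case (Suc k)
  show ?case
  proof (rule Ck_on_SucI[OF assms(1) Deriv.has_derivative_inverse])
    fix v
    have "Ck_on k (\<lambda>x. frechet_derivative f (at x) v) S"
      using Suc.prems by simp
    then have "Ck_on k (\<lambda>x. -1 * (inverse (f x) * frechet_derivative f (at x) v * inverse (f x))) S"
      using Suc.IH[OF Ck_on_lower[OF Suc.prems]]
      by (intro Ck_on_mult Ck_on_const assms(1))
    then show "Ck_on k (\<lambda>x. - (inverse (f x) * frechet_derivative f (at x) v * inverse (f x))) S"
      by simp
  qed (rule assms(2), assumption, rule Ck_on_has_derivative[OF Suc.prems], assumption)
qed

section \<open>Flat functions and smooth steps\<close>

text \<open>
  The functions $t^{-n} e^{-1/t}$ for \<open>t > 0\<close>, extended by zero.  Only \<open>n = 0\<close> is wanted; the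
  others are needed because differentiation maps this family into its own linear span, which makes
  smoothness an induction.
\<close>
definition flat :: "nat \<Rightarrow> real \<Rightarrow> real" where
  "flat n t = (if t \<le> 0 then 0 else exp (- inverse t) * inverse t ^ n)"

text \<open>
  With \<open>u = 1 / t\<close> this says that $u^n e^{-u}$ tends to zero at infinity.
\<close>
lemma flat_tendsto_0: "(flat n \<longlongrightarrow> 0) (at 0)"
proof -
  have "((\<lambda>t. inverse t ^ n / exp (inverse t)) \<longlongrightarrow> (0::real)) (at_right 0)"
    by (rule filterlim_compose[OF tendsto_power_div_exp_0 filterlim_inverse_at_top_right])
  then have "(flat n \<longlongrightarrow> 0) (at_right 0)"
    by (rule Lim_transform_eventually)
      (auto simp: flat_def exp_minus field_simps eventually_at_filter)
  moreover have "(flat n \<longlongrightarrow> 0) (at_left 0)"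
    by (rule Lim_transform_eventually[OF tendsto_const])
      (auto simp: flat_def eventually_at_filter)
  ultimately show ?thesis by (simp add: filterlim_split_at)
qed

lemma flat_has_derivative:
  "(flat n has_real_derivative flat (n + 2) t - real n * flat (n + 1) t) (at t)"
proof (cases t "0::real" rule: linorder_cases)
  case less
  have "((\<lambda>t. 0) has_real_derivative 0) (at t)" by simp
  then have "(flat n has_real_derivative 0) (at t)"
    by (rule DERIV_cong_ev[THEN iffD1, rotated -1])
      (use less in \<open>auto simp: flat_def eventually_nhds intro!: exI[of _ "{..<0}"]\<close>)
  with less show ?thesis by (simp add: flat_def)
next
  case equal
    \<comment> \<open>The difference quotient at zero is again a member of the family.\<close>
  have "flat n h / h = flat (Suc n) h" for h
    by (simp add: flat_def field_simps)
  moreover have "flat m 0 = 0" for m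
    by (simp add: flat_def)
  ultimately show ?thesis
    using flat_tendsto_0[of "Suc n"] equal by (simp add: has_field_derivative_iff)
next
  case greater
  have "((\<lambda>t. exp (- inverse t) * inverse t ^ n) has_real_derivative
      flat (n + 2) t - real n * flat (n + 1) t) (at t)"
    using greater
    by (auto intro!: derivative_eq_intros simp: flat_def power2_eq_square)
      (cases n; simp add: field_simps)
  then show ?thesis
    by (rule DERIV_cong_ev[THEN iffD1, rotated -1])
      (use greater in \<open>auto simp: flat_def eventually_nhds intro!: exI[of _ "{0<..}"]\<close>)
qed

text \<open>
  Stated for the composite with \<open>q\<close>, so that the chain rule for a scalar inner function is the only
  one needed: the derivative is a combination of two other members of the family, composed with \<open>q\<close>,
  times the derivative of \<open>q\<close>.
\<close>
lemma Ck_on_flat_compose: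
  assumes "open S" "Ck_on k q S"
  shows "Ck_on k (\<lambda>x. flat n (q x)) S"
  using assms(2)
proof (induction k arbitrary: n)
  case 0
  have "continuous_on UNIV (flat n)"
    by (meson DERIV_isCont continuous_at_imp_continuous_on flat_has_derivative)
  with 0 show ?case by (auto intro: continuous_on_compose2)
next
  case (Suc k)
  show ?case
  proof (rule Ck_on_SucI[OF assms(1)])
    fix x assume "x \<in> S"
    show "((\<lambda>x. flat n (q x)) has_derivative
        (\<lambda>v. frechet_derivative q (at x) v * (flat (n + 2) (q x) - real n * flat (n + 1) (q x)))) (at x)"
      by (rule DERIV_compose_FDERIV[OF flat_has_derivative Ck_on_has_derivative[OF Suc.prems \<open>x \<in> S\<close>]])
  next
    fix v
    show "Ck_on k (\<lambda>x. frechet_derivative q (at x) v *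
        (flat (n + 2) (q x) - real n * flat (n + 1) (q x))) S"
      using Suc.prems Suc.IH[OF Ck_on_lower[OF Suc.prems]]
      by (intro Ck_on_mult Ck_on_diff Ck_on_const assms(1)) auto
  qed
qed

definition smooth_step :: "real \<Rightarrow> real \<Rightarrow> real \<Rightarrow> real" where
  "smooth_step a b t = flat 0 (b - t) * inverse (flat 0 (b - t) + flat 0 (t - a))"

lemma smooth_step_eq_1: "a < b \<Longrightarrow> t \<le> a \<Longrightarrow> smooth_step a b t = 1"
  by (simp add: smooth_step_def flat_def)

lemma smooth_step_eq_0: "b \<le> t \<Longrightarrow> smooth_step a b t = 0"
  by (simp add: smooth_step_def flat_def)

text \<open>
  The denominator never vanishes: as \<open>a < b\<close>, each \<open>t\<close> has \<open>t < b\<close> or \<open>a < t\<close>.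
\<close>
lemma Ck_on_smooth_step_compose:
  assumes "open S" "Ck_on k q S" "a < b"
  shows "Ck_on k (\<lambda>x. smooth_step a b (q x)) S"
proof -
  have "flat 0 (b - t) + flat 0 (t - a) \<noteq> 0" for t
  proof (cases "t < b")
    case True
    then have "flat 0 (b - t) > 0" "flat 0 (t - a) \<ge> 0"
      by (simp_all add: flat_def)
    then show ?thesis by linarith
  next
    case False
    with \<open>a < b\<close> show ?thesis by (simp add: flat_def)
  qed
  then show ?thesis
    unfolding smooth_step_def
    by (intro Ck_on_mult Ck_on_inverse Ck_on_add Ck_on_flat_compose Ck_on_diff Ck_on_const assms) auto
qed

section \<open>Finite-dimensional inner product spaces\<close>

text \<open>
  Gram--Schmidt, with the zero vectors that it may leave thrown away and the others normalised.
  Coordinates in such a basis are bounded by the norm; this is what compactness of balls and bounds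
  on linear maps below rely on.
\<close>
lemma finite_dim_orthonormal_basis:
  assumes "\<exists>B::'e::real_inner set. finite B \<and> span B = UNIV"
  obtains E :: "'e::real_inner set" where "finite E" "\<forall>b\<in>E. norm b = 1"
    "\<forall>v. (\<Sum>b\<in>E. (v \<bullet> b) *\<^sub>R b) = v"
proof -
  obtain B :: "'e set" where "finite B" "span B = UNIV"
    using assms by blast
  from basis_orthogonal[OF this(1)]
  obtain C where C: "finite C" "span C = span B" "pairwise orthogonal C"
    by auto
  define E where "E = (\<lambda>c. c /\<^sub>R norm c) ` (C - {0})"
  have unit: "norm b = 1" if b: "b \<in> E" for b
  proof -
    obtain c where "c \<noteq> 0" "b = c /\<^sub>R norm c"
      using b by (auto simp: E_def)
    then show ?thesis by simp
  qed
  have "finite E" using C(1) by (simp add: E_def)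
  have orth: "a \<bullet> b = 0" if ab: "a \<in> E" "b \<in> E" "a \<noteq> b" for a b
  proof -
    obtain c c' where c: "c \<in> C" "c' \<in> C" "a = c /\<^sub>R norm c" "b = c' /\<^sub>R norm c'"
      using ab(1,2) by (auto simp: E_def)
    with ab(3) have "c \<noteq> c'" by auto
    with c C(3) have "c \<bullet> c' = 0" by (simp add: pairwise_def orthogonal_def)
    with c show ?thesis by simp
  qed
  have "c \<in> span E" if "c \<in> C" for c
  proof (cases "c = 0")
    case False
    then have "c = norm c *\<^sub>R (c /\<^sub>R norm c)" by simp
    moreover have "c /\<^sub>R norm c \<in> E" using that False by (auto simp: E_def)
    ultimately show ?thesis by (metis span_base span_scale)
  qed (simp add: span_zero)
  then have "span E = UNIV"
    using \<open>span B = UNIV\<close> C(2) span_minimal[of C "span E"] by (auto simp: subset_eq)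
  have "(\<Sum>b\<in>E. (v \<bullet> b) *\<^sub>R b) = v" for v
  proof -
    obtain u where u: "v = (\<Sum>b\<in>E. u b *\<^sub>R b)"
      using \<open>span E = UNIV\<close> unfolding span_finite[OF \<open>finite E\<close>] by blast
    have "v \<bullet> b = u b" if "b \<in> E" for b
    proof -
      have "v \<bullet> b = (\<Sum>a\<in>E. u a * (a \<bullet> b))"
        by (simp add: u inner_sum_left)
      also have "\<dots> = (\<Sum>a\<in>E. if a = b then u a else 0)"
        using orth unit that by (intro sum.cong) (auto simp: dot_square_norm)
      finally show ?thesis using \<open>finite E\<close> that by simp
    qed
    then have "(\<Sum>b\<in>E. u b *\<^sub>R b) = (\<Sum>b\<in>E. (v \<bullet> b) *\<^sub>R b)"
      by (intro sum.cong) simp_all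
    with u show ?thesis by simp
  qed
  with \<open>finite E\<close> unit show ?thesis using that by blast
qed

lemma compact_cball_finite_dim:
  fixes x :: "'e::real_inner"
  assumes "\<exists>B::'e set. finite B \<and> span B = UNIV"
  shows "compact (cball x r)"
proof -
  obtain E :: "'e set" where E: "finite E" "\<forall>b\<in>E. norm b = 1"
    "\<forall>v. (\<Sum>b\<in>E. (v \<bullet> b) *\<^sub>R b) = v"
    by (rule finite_dim_orthonormal_basis[OF assms])
  \<comment> \<open>A box is a sum of finitely many segments; the ball is a closed subset of a box.\<close>
  have box: "compact {\<Sum>b\<in>F. c b *\<^sub>R b | c. \<forall>b\<in>F. \<bar>c b\<bar> \<le> R}" if "finite F" for F :: "'e set" and R
    using that
  proof (induction F)
    case empty
    then show ?case by simp
  next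
    case (insert a F)
    let ?S = "(\<lambda>t. t *\<^sub>R a) ` {-R..R}" and ?T = "{\<Sum>b\<in>F. c b *\<^sub>R b | c. \<forall>b\<in>F. \<bar>c b\<bar> \<le> R}"
    have "compact {x + y | x y. x \<in> ?S \<and> y \<in> ?T}"
      by (intro compact_sums insert.IH compact_continuous_image continuous_intros) simp
    moreover have "{x + y | x y. x \<in> ?S \<and> y \<in> ?T} =
        {\<Sum>b\<in>insert a F. c b *\<^sub>R b | c. \<forall>b\<in>insert a F. \<bar>c b\<bar> \<le> R}" (is "?X = ?Y")
    proof (intro equalityI subsetI)
      fix z assume "z \<in> ?X"
      then obtain t c where z: "z = t *\<^sub>R a + (\<Sum>b\<in>F. c b *\<^sub>R b)" and tc: "\<bar>t\<bar> \<le> R" "\<forall>b\<in>F. \<bar>c b\<bar> \<le> R"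
        by (auto simp: abs_le_iff)
      have "(\<Sum>b\<in>F. (c(a := t)) b *\<^sub>R b) = (\<Sum>b\<in>F. c b *\<^sub>R b)"
        using insert.hyps by (intro sum.cong) auto
      then have "z = (\<Sum>b\<in>insert a F. (c(a := t)) b *\<^sub>R b)"
        using insert.hyps z by simp
      with tc show "z \<in> ?Y" by (auto intro!: exI[of _ "c(a := t)"])
    next
      fix z assume "z \<in> ?Y"
      then obtain c where c: "z = c a *\<^sub>R a + (\<Sum>b\<in>F. c b *\<^sub>R b)" "\<forall>b\<in>insert a F. \<bar>c b\<bar> \<le> R"
        using insert.hyps by auto
      then have "c a *\<^sub>R a \<in> ?S" "(\<Sum>b\<in>F. c b *\<^sub>R b) \<in> ?T" by (auto simp: abs_le_iff)
      with c(1) show "z \<in> ?X" by blast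
    qed
    ultimately show ?case by simp
  qed
  have "cball 0 r \<subseteq> {\<Sum>b\<in>E. c b *\<^sub>R b | c. \<forall>b\<in>E. \<bar>c b\<bar> \<le> r}"
  proof
    fix v :: 'e assume v: "v \<in> cball 0 r"
    have "\<bar>v \<bullet> b\<bar> \<le> r" if "b \<in> E" for b
      using Cauchy_Schwarz_ineq2[of v b] E(2) that v by simp
    moreover have "v = (\<Sum>b\<in>E. (v \<bullet> b) *\<^sub>R b)"
      using E(3) by simp
    ultimately show "v \<in> {\<Sum>b\<in>E. c b *\<^sub>R b | c. \<forall>b\<in>E. \<bar>c b\<bar> \<le> r}" by blast
  qed
  then have "{\<Sum>b\<in>E. c b *\<^sub>R b | c. \<forall>b\<in>E. \<bar>c b\<bar> \<le> r} \<inter> cball 0 r = cball 0 r"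
    by (rule Int_absorb1)
  with compact_Int_closed[OF box[OF E(1), of r] closed_cball[of 0 r]] have "compact (cball (0::'e) r)"
    by simp
  then have "compact ((\<lambda>v. x + v) ` cball 0 r)"
    by (rule compact_translation)
  then show ?thesis by simp
qed

text \<open>
  The finitely many partial derivatives along an orthonormal basis are continuous, hence bounded near
  \<open>p\<close>; so the operator norm of the derivative is bounded there, and the mean value inequality on
  a ball gives the Lipschitz bound.
\<close>
lemma C1_locally_lipschitz:
  fixes f :: "'e::real_inner \<Rightarrow> real"
  assumes fd: "\<exists>B::'e set. finite B \<and> span B = UNIV"
    and "open S" "p \<in> S" "Ck_on 1 f S"
  obtains r C where "r > 0" "C \<ge> 0" "ball p r \<subseteq> S"
    "\<And>x y. x \<in> ball p r \<Longrightarrow> y \<in> ball p r \<Longrightarrow> \<bar>f x - f y\<bar> \<le> C * dist x y"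
proof -
  obtain E :: "'e set" where E: "finite E" "\<forall>b\<in>E. norm b = 1"
    "\<forall>v. (\<Sum>b\<in>E. (v \<bullet> b) *\<^sub>R b) = v"
    by (rule finite_dim_orthonormal_basis[OF fd])
  define D where "D x = frechet_derivative f (at x)" for x
  have D: "(f has_derivative D x) (at x)" if "x \<in> S" for x
    unfolding D_def using Ck_on_has_derivative[of 0 f S x] assms(4) that by simp
  have "isCont (\<lambda>x. D x b) p" for b
    using assms(2-4) by (simp add: D_def continuous_on_eq_continuous_at)
  \<comment> \<open>Near \<open>p\<close> every partial derivative stays within 1 of its value at \<open>p\<close>.\<close>
  then have "((\<lambda>x. D x b) \<longlongrightarrow> D p b) (nhds p)" for b
    unfolding isCont_def by (rule tendsto_at_iff_tendsto_nhds[of "\<lambda>x. D x b" p, THEN iffD1])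
  then have "\<forall>\<^sub>F x in nhds p. dist (D x b) (D p b) < 1" for b
    by (rule tendstoD) simp
  then have "\<forall>\<^sub>F x in nhds p. \<forall>b\<in>E. dist (D x b) (D p b) < 1"
    using E(1) by (simp add: eventually_ball_finite)
  moreover have "\<forall>\<^sub>F x in nhds p. x \<in> S"
    using assms(2,3) by (rule eventually_nhds_in_open)
  ultimately have "\<forall>\<^sub>F x in nhds p. x \<in> S \<and> (\<forall>b\<in>E. dist (D x b) (D p b) < 1)"
    by (rule eventually_conj[rotated])
  then obtain r where r: "r > 0"
    "\<And>x. dist x p < r \<Longrightarrow> x \<in> S \<and> (\<forall>b\<in>E. dist (D x b) (D p b) < 1)"
    unfolding eventually_nhds_metric by blast
  define C where "C = (\<Sum>b\<in>E. \<bar>D p b\<bar> + 1)"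
  have "onorm (D x) \<le> C" if "dist x p < r" for x
  proof (rule onorm_bound)
    show "0 \<le> C" by (simp add: C_def sum_nonneg)
    fix v
    interpret bounded_linear "D x"
      using D[of x] r(2)[OF that] by (blast intro: has_derivative_bounded_linear)
    have "D x v = D x (\<Sum>b\<in>E. (v \<bullet> b) *\<^sub>R b)"
      by (simp add: E(3))
    then have "D x v = (\<Sum>b\<in>E. (v \<bullet> b) * D x b)"
      by (simp add: sum scaleR)
    also have "\<bar>\<dots>\<bar> \<le> (\<Sum>b\<in>E. (\<bar>D p b\<bar> + 1) * norm v)"
    proof (rule order_trans[OF sum_abs sum_mono])
      fix b assume b: "b \<in> E"
      have "\<bar>v \<bullet> b\<bar> \<le> norm v"
        using Cauchy_Schwarz_ineq2[of v b] E(2) b by simp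
      moreover have "\<bar>D x b\<bar> \<le> \<bar>D p b\<bar> + 1"
        using r(2)[OF that] b by (fastforce simp: dist_real_def)
      ultimately have "\<bar>v \<bullet> b\<bar> * \<bar>D x b\<bar> \<le> norm v * (\<bar>D p b\<bar> + 1)"
        by (intro mult_mono) auto
      then show "\<bar>(v \<bullet> b) * D x b\<bar> \<le> (\<bar>D p b\<bar> + 1) * norm v"
        by (simp add: abs_mult mult.commute)
    qed
    finally show "norm (D x v) \<le> C * norm v"
      by (simp add: C_def sum_distrib_right)
  qed
  moreover have "(f has_derivative D z) (at z within ball p r)" if "z \<in> ball p r" for z
    by (rule has_derivative_at_withinI[OF D]) (use r(2) that in \<open>simp add: dist_commute\<close>)
  ultimately have "norm (f x - f y) \<le> C * norm (x - y)" if "x \<in> ball p r" "y \<in> ball p r" for x y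
    using that by (intro differentiable_bound[OF convex_ball[of p r], where f' = D])
      (simp_all add: dist_commute)
  moreover have "ball p r \<subseteq> S" using r(2) by (auto simp: dist_commute)
  moreover have "0 \<le> C" by (simp add: C_def sum_nonneg)
  ultimately show ?thesis using that r(1) by (simp add: dist_norm)
qed

section \<open>Smooth functions and cutoffs on a manifold\<close>

context smooth_manifold
begin

lemma chart_inverse: "(U, \<phi>) \<in> A \<Longrightarrow> x \<in> U \<Longrightarrow> inv_into U \<phi> (\<phi> x) = x"
  by (rule homeomorphism_apply1[OF chart_homeomorphism])

lemma chart_open_map:
  assumes "(U, \<phi>) \<in> A" "open N" "N \<subseteq> U"
  shows "open (\<phi> ` N)"
proof -
  have "openin (top_of_set (\<phi> ` U)) (\<phi> ` N)"
    using assms by (intro homeomorphism_imp_open_map[OF chart_homeomorphism] open_subset)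
  then show ?thesis
    by (rule openin_open_trans[OF _ chart_image_open[OF assms(1)]])
qed

lemma chart_at: obtains U \<phi> where "(U, \<phi>) \<in> A" "x \<in> U"
proof -
  from charts_cover have "x \<in> (\<Union>(U, \<phi>)\<in>A. U)" by simp
  then show ?thesis using that by blast
qed

lemma smooth_functionsD:
  "f \<in> smooth_functions A \<Longrightarrow> (U, \<phi>) \<in> A \<Longrightarrow> Ck_on k (f \<circ> inv_into U \<phi>) (\<phi> ` U)"
  by (auto simp: smooth_functions_def Cinf_on_def)

lemma smooth_functionsI:
  assumes "\<And>U \<phi> k. (U, \<phi>) \<in> A \<Longrightarrow> Ck_on k (f \<circ> inv_into U \<phi>) (\<phi> ` U)"
  shows "f \<in> smooth_functions A"
  using assms by (auto simp: smooth_functions_def Cinf_on_def)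

lemma smooth_const: "(\<lambda>x. c) \<in> smooth_functions A"
  by (rule smooth_functionsI) (simp add: comp_def Ck_on_const chart_image_open)

lemma smooth_mult:
  assumes "f \<in> smooth_functions A" "g \<in> smooth_functions A"
  shows "(\<lambda>x. f x * g x) \<in> smooth_functions A"
proof (rule smooth_functionsI)
  fix U \<phi> k assume U: "(U, \<phi>) \<in> A"
  show "Ck_on k ((\<lambda>x. f x * g x) \<circ> inv_into U \<phi>) (\<phi> ` U)"
    using Ck_on_mult[OF chart_image_open[OF U] smooth_functionsD[OF assms(1) U]
        smooth_functionsD[OF assms(2) U]]
    by (simp add: comp_def)
qed

lemma smooth_diff:
  assumes "f \<in> smooth_functions A" "g \<in> smooth_functions A"
  shows "(\<lambda>x. f x - g x) \<in> smooth_functions A"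
proof (rule smooth_functionsI)
  fix U \<phi> k assume U: "(U, \<phi>) \<in> A"
  show "Ck_on k ((\<lambda>x. f x - g x) \<circ> inv_into U \<phi>) (\<phi> ` U)"
    using Ck_on_diff[OF chart_image_open[OF U] smooth_functionsD[OF assms(1) U]
        smooth_functionsD[OF assms(2) U]]
    by (simp add: comp_def)
qed

lemma smooth_prod:
  assumes "finite I" "\<And>i. i \<in> I \<Longrightarrow> f i \<in> smooth_functions A"
  shows "(\<lambda>x. \<Prod>i\<in>I. f i x) \<in> smooth_functions A"
  using assms by (induction I rule: finite_induct) (auto simp: smooth_const intro!: smooth_mult)

text \<open>
  In a chart, take a smooth step of the squared distance to the image of \<open>p\<close>, and extend by zero
  outside the chart domain.  The support \<open>L\<close> lies over a closed ball, so it is compact, hence closed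
  because the manifold is Hausdorff.  Any other chart domain is covered by its intersection with the
  first one, where smoothness comes from the transition map, and by the complement of \<open>L\<close>, where the
  function vanishes.
\<close>
lemma smooth_bump_at:
  fixes p :: 'a
  shows "\<exists>b\<in>smooth_functions A. \<exists>N L. open N \<and> p \<in> N \<and> compact L \<and>
    (\<forall>x\<in>N. b x = 1) \<and> (\<forall>x. x \<notin> L \<longrightarrow> b x = 0)"
proof -
  obtain U \<phi> where U: "(U, \<phi>) \<in> A" "p \<in> U"
    by (rule chart_at)
  obtain r where r: "r > 0" "cball (\<phi> p) r \<subseteq> \<phi> ` U"
    using open_contains_cball[of "\<phi> ` U"] chart_image_open[OF U(1)] U(2) by blast
  define q where "q e = (e - \<phi> p) \<bullet> (e - \<phi> p)" for e
  define b where "b x = (if x \<in> U then smooth_step ((r/2)\<^sup>2) (r\<^sup>2) (q (\<phi> x)) else 0)" for x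
  define L where "L = inv_into U \<phi> ` cball (\<phi> p) r"
  define N where "N = U \<inter> \<phi> -` ball (\<phi> p) (r/2)"
  have q: "q e = (dist (\<phi> p) e)\<^sup>2" for e
    by (simp add: q_def dot_square_norm dist_norm norm_minus_commute)
  have radii: "(r/2)\<^sup>2 < r\<^sup>2"
    using r(1) by (intro power_strict_mono) auto
  have "continuous_on (cball (\<phi> p) r) (inv_into U \<phi>)"
    using homeomorphism_cont2[OF chart_homeomorphism[OF U(1)]] r(2) by (rule continuous_on_subset)
  then have "compact L"
    unfolding L_def by (intro compact_continuous_image compact_cball_finite_dim finite_dim)
  have "continuous_on U \<phi>"
    by (rule homeomorphism_cont1[OF chart_homeomorphism[OF U(1)]])
  then have "open N"
    unfolding N_def using chart_open[OF U(1)] open_ball by (rule continuous_open_preimage)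
  have b1: "b x = 1" if "x \<in> N" for x
  proof -
    have "q (\<phi> x) \<le> (r/2)\<^sup>2"
      using that unfolding q N_def by (intro power_mono) auto
    with that radii show ?thesis by (simp add: b_def N_def smooth_step_eq_1)
  qed
  have b0: "b x = 0" if x: "x \<notin> L" for x
  proof (cases "x \<in> U")
    case True
    then have "inv_into U \<phi> (\<phi> x) = x" by (rule chart_inverse[OF U(1)])
    with x have "\<phi> x \<notin> cball (\<phi> p) r" unfolding L_def by (metis imageI)
    then have "r\<^sup>2 \<le> q (\<phi> x)"
      using r(1) unfolding q by (intro power_mono) auto
    with True show ?thesis by (simp add: b_def smooth_step_eq_0)
  qed (simp add: b_def)
  have "b \<in> smooth_functions A"
  proof (rule smooth_functionsI, rule Ck_on_local)
    fix V \<psi> k y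
    assume V: "(V, \<psi>) \<in> A" and "y \<in> \<psi> ` V"
    then obtain x where x: "x \<in> V" "y = \<psi> x" by blast
    show "\<exists>T. open T \<and> y \<in> T \<and> Ck_on k (b \<circ> inv_into V \<psi>) T"
    proof (cases "x \<in> U")
      case True
      let ?T = "\<psi> ` (V \<inter> U)"
      have T: "open ?T"
        using chart_open[OF U(1)] chart_open[OF V] by (intro chart_open_map[OF V]) auto
      have "Ck_on k (\<phi> \<circ> inv_into V \<psi>) ?T"
        using transition_smooth[OF V U(1)] by (simp add: Cinf_on_def)
      moreover have "Ck_on k (\<lambda>y. - \<phi> p) ?T"
        by (rule Ck_on_const[OF T])
      ultimately have "Ck_on k (\<lambda>y. (\<phi> \<circ> inv_into V \<psi>) y + - \<phi> p) ?T"
        by (rule Ck_on_add[OF T])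
      then have "Ck_on k (\<lambda>y. q ((\<phi> \<circ> inv_into V \<psi>) y)) ?T"
        unfolding q_def by (intro Ck_on_inner T) simp_all
      then have "Ck_on k (\<lambda>y. smooth_step ((r/2)\<^sup>2) (r\<^sup>2) (q ((\<phi> \<circ> inv_into V \<psi>) y))) ?T"
        by (rule Ck_on_smooth_step_compose[OF T _ radii])
      then have "Ck_on k (b \<circ> inv_into V \<psi>) ?T"
        by (rule Ck_on_cong[OF T, rotated]) (auto simp: b_def chart_inverse[OF V])
      with T True x show ?thesis by (intro exI[of _ ?T]) simp
    next
      case False
      let ?T = "\<psi> ` (V - L)"
      have T: "open ?T"
        using compact_imp_closed[OF \<open>compact L\<close>] chart_open[OF V]
        by (intro chart_open_map[OF V]) auto
      have "Ck_on k (b \<circ> inv_into V \<psi>) ?T"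
        by (rule Ck_on_cong[OF T _ Ck_on_const[OF T]]) (auto simp: b0 chart_inverse[OF V])
      moreover have "L \<subseteq> U"
        unfolding L_def using r(2) by (auto intro: inv_into_into)
      with False have "x \<notin> L" by blast
      ultimately show ?thesis using T x by (intro exI[of _ ?T]) simp
    qed
  qed
  moreover have "p \<in> N" using U(2) r(1) by (simp add: N_def)
  ultimately show ?thesis
    using \<open>open N\<close> \<open>compact L\<close> b1 b0
    by (intro bexI[of _ b] exI[of _ N] exI[of _ L] conjI ballI allI impI)
qed

text \<open>
  With finitely many bumps whose sets \<open>N p\<close> cover \<open>K\<close>, the function $1 - \prod_p (1 - b_p)$ equals 1
  wherever one of the bumps does, and vanishes where all of them vanish.
\<close>
lemma smooth_cutoff:
  assumes "compact K"
  obtains h N L where "h \<in> smooth_functions A" "open N" "K \<subseteq> N" "compact L"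
    "\<And>x. x \<in> N \<Longrightarrow> h x = 1" "\<And>x. x \<notin> L \<Longrightarrow> h x = 0"
proof -
  obtain b N L where b: "\<And>p. b p \<in> smooth_functions A" "\<And>p. open (N p)" "\<And>p. p \<in> N p"
    "\<And>p. compact (L p)" "\<And>p x. x \<in> N p \<Longrightarrow> b p x = 1" "\<And>p x. x \<notin> L p \<Longrightarrow> b p x = 0"
    using smooth_bump_at by metis
  have "K \<subseteq> (\<Union>p\<in>K. N p)" using b(3) by blast
  then obtain I where I: "finite I" "K \<subseteq> (\<Union>p\<in>I. N p)"
    by (rule compactE_image[OF assms b(2)])
  define h where "h x = 1 - (\<Prod>p\<in>I. 1 - b p x)" for x
  show ?thesis
  proof
    show "h \<in> smooth_functions A"
      unfolding h_def using I(1) b(1) by (intro smooth_diff smooth_prod smooth_const)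
    show "open (\<Union>p\<in>I. N p)" using b(2) by blast
    show "K \<subseteq> (\<Union>p\<in>I. N p)" by (rule I(2))
    show "compact (\<Union>p\<in>I. L p)" using I(1) b(4) by (rule compact_UN)
    show "h x = 1" if "x \<in> (\<Union>p\<in>I. N p)" for x
      using that b(5) I(1) by (force simp: h_def)
    show "h x = 0" if "x \<notin> (\<Union>p\<in>I. L p)" for x
      using that b(6) by (simp add: h_def)
  qed
qed

end

section \<open>Smooth functions and the distance to their zeros\<close>

lemma dist_to_set_nonneg:
  assumes "manifold_distance A d"
  shows "0 \<le> dist_to_set d x X"
proof -
  have "Metric_space UNIV d" using assms by (simp add: manifold_distance_def)
  then have "0 \<le> d x y" for y by (rule Metric_space.nonneg)
  then show ?thesis by (auto simp: dist_to_set_def intro!: cINF_greatest)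
qed

lemma le_mult_dist_to_set:
  assumes "C > 0" "\<And>z. z \<in> X \<Longrightarrow> t \<le> C * d x z" "X = {} \<Longrightarrow> t \<le> C"
  shows "t \<le> C * dist_to_set d x X"
proof (cases "X = {}")
  case False
  have "t / C \<le> (INF z\<in>X. d x z)"
    using assms(1,2) False by (intro cINF_greatest) (auto simp: pos_divide_le_eq mult.commute)
  with assms(1) False show ?thesis
    by (simp add: dist_to_set_def pos_divide_le_eq mult.commute)
qed (use assms in \<open>simp add: dist_to_set_def\<close>)

context smooth_manifold
begin

text \<open>
  In a chart \<open>g\<close> is Lipschitz for the Euclidean distance on a small ball, and there \<open>d\<close> bounds
  the Euclidean distance up to a constant.
\<close>
lemma smooth_locally_lipschitz:
  assumes d: "manifold_distance A d" and g: "g \<in> smooth_functions A"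
  shows "\<exists>\<rho>>0. \<exists>C\<ge>0. \<forall>y z. d p y < \<rho> \<longrightarrow> d p z < \<rho> \<longrightarrow> \<bar>g y - g z\<bar> \<le> C * d y z"
proof -
  interpret Metric_space UNIV d
    using d by (simp add: manifold_distance_def)
  obtain U \<phi> where U: "(U, \<phi>) \<in> A" "p \<in> U"
    by (rule chart_at)
  have "\<forall>(U, \<phi>)\<in>A. \<forall>x\<in>U. \<exists>W c C. open W \<and> x \<in> W \<and> W \<subseteq> U \<and> 0 < c \<and> 0 < C \<and>
      (\<forall>y\<in>W. \<forall>z\<in>W. c * dist (\<phi> y) (\<phi> z) \<le> d y z \<and> d y z \<le> C * dist (\<phi> y) (\<phi> z))"
    using d by (simp add: manifold_distance_def)
  from bspec[OF this U(1), simplified, THEN bspec, OF U(2)]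
  obtain W c where W: "open W" "p \<in> W" "W \<subseteq> U" "c > 0"
    and "\<forall>y\<in>W. \<forall>z\<in>W. c * dist (\<phi> y) (\<phi> z) \<le> d y z"
    by auto
  then have cd: "c * dist (\<phi> y) (\<phi> z) \<le> d y z" if "y \<in> W" "z \<in> W" for y z
    using that by blast
  have "Ck_on 1 (g \<circ> inv_into U \<phi>) (\<phi> ` U)"
    using smooth_functionsD[OF g U(1)] .
  then obtain r C where C: "r > 0" "C \<ge> 0"
    "\<And>y z. y \<in> ball (\<phi> p) r \<Longrightarrow> z \<in> ball (\<phi> p) r \<Longrightarrow>
      \<bar>(g \<circ> inv_into U \<phi>) y - (g \<circ> inv_into U \<phi>) z\<bar> \<le> C * dist y z"
    using C1_locally_lipschitz[OF finite_dim chart_image_open[OF U(1)] imageI[OF U(2)]] by metis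
  define N where "N = W \<inter> \<phi> -` ball (\<phi> p) r"
  have "continuous_on W \<phi>"
    using homeomorphism_cont1[OF chart_homeomorphism[OF U(1)]] W(3) by (rule continuous_on_subset)
  then have "open N"
    unfolding N_def using W(1) open_ball by (rule continuous_open_preimage)
  then have "openin mtopology N"
    using d by (simp add: manifold_distance_def)
  moreover have "p \<in> N" using W(2) C(1) by (simp add: N_def)
  ultimately obtain \<rho> where \<rho>: "\<rho> > 0" "mball p \<rho> \<subseteq> N"
    unfolding openin_mtopology by blast
  have "\<bar>g y - g z\<bar> \<le> C / c * d y z" if "d p y < \<rho>" "d p z < \<rho>" for y z
  proof -
    have yz: "y \<in> N" "z \<in> N" using that \<rho>(2) by auto
    then have "\<bar>g y - g z\<bar> \<le> C * dist (\<phi> y) (\<phi> z)"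
      using C(3)[of "\<phi> y" "\<phi> z"] W(3) chart_inverse[OF U(1)] by (auto simp: N_def subset_eq)
    also have "\<dots> = C / c * (c * dist (\<phi> y) (\<phi> z))" using W(4) by simp
    also have "\<dots> \<le> C / c * d y z"
      using yz W(4) C(2) by (intro mult_left_mono cd) (auto simp: N_def)
    finally show ?thesis .
  qed
  moreover have "0 \<le> C / c" using W(4) C(2) by simp
  ultimately show ?thesis using \<rho>(1) by blast
qed

text \<open>
  For \<open>y\<close> near \<open>p\<close>, a point \<open>z\<close> of \<open>Z\<close> that is close to \<open>y\<close> is handled by the Lipschitz bound,
  as \<open>g z = 0\<close>; a point at distance at least \<open>\<delta>\<close> is handled by boundedness of \<open>g\<close> near \<open>p\<close>.
  The constant \<open>B\<close> serves both cases; it also exceeds the bound \<open>M\<close> because the distance to the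
  empty set is 1.
\<close>
lemma smooth_le_distance_locally:
  assumes d: "manifold_distance A d" and g: "g \<in> smooth_functions A"
    and Z: "\<And>z. z \<in> Z \<Longrightarrow> g z = 0"
  shows "\<exists>N C. open N \<and> p \<in> N \<and> C > 0 \<and> (\<forall>y\<in>N. \<bar>g y\<bar> \<le> C * dist_to_set d y Z)"
proof -
  interpret Metric_space UNIV d
    using d by (simp add: manifold_distance_def)
  obtain \<rho> C where \<rho>: "\<rho> > 0" and C: "C \<ge> 0"
    "\<And>y z. d p y < \<rho> \<Longrightarrow> d p z < \<rho> \<Longrightarrow> \<bar>g y - g z\<bar> \<le> C * d y z"
    using smooth_locally_lipschitz[OF d g] by metis
  define \<delta> where "\<delta> = \<rho> / 2"
  define M where "M = \<bar>g p\<bar> + C * \<delta>"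
  define B where "B = C + M / \<delta> + M + 1"
  have \<delta>: "\<delta> > 0" "\<delta> < \<rho>" using \<rho> by (simp_all add: \<delta>_def)
  have M: "M \<ge> 0" using C(1) \<delta>(1) by (simp add: M_def)
  have B: "B > 0" "C \<le> B" "M / \<delta> \<le> B" "M \<le> B"
    using C(1) M \<delta>(1) by (simp_all add: B_def add_nonneg_pos)
  have "\<bar>g y\<bar> \<le> B * dist_to_set d y Z" if y: "d p y < \<delta>" for y
  proof (rule le_mult_dist_to_set[where C = B])
    have "\<bar>g y - g p\<bar> \<le> C * d y p"
      using y \<delta> \<rho> by (intro C(2)) auto
    also have "\<dots> \<le> C * \<delta>"
      using y C(1) by (intro mult_left_mono) (simp_all add: commute)
    finally have gM: "\<bar>g y\<bar> \<le> M" by (simp add: M_def)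
    then show "\<bar>g y\<bar> \<le> B" using B(4) by simp
    fix z assume z: "z \<in> Z"
    show "\<bar>g y\<bar> \<le> B * d y z"
    proof (cases "d y z < \<delta>")
      case True
      then have "d p z < \<rho>"
        using triangle[of p y z] y by (simp add: \<delta>_def)
      then have "\<bar>g y - g z\<bar> \<le> C * d y z"
        using y \<delta> by (intro C(2)) auto
      also have "\<dots> \<le> B * d y z"
        using B(2) by (intro mult_right_mono) auto
      finally show ?thesis using Z[OF z] by simp
    next
      case False
      have "M = M / \<delta> * \<delta>" using \<delta>(1) by simp
      also have "\<dots> \<le> B * d y z"
        using False B \<delta>(1) by (intro mult_mono) auto
      finally show ?thesis using gM by simp
    qed
  qed (rule B(1))
  moreover have "open (mball p \<delta>)"
    using d openin_mball[of p \<delta>] by (simp add: manifold_distance_def)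
  moreover have "p \<in> mball p \<delta>" using \<delta>(1) by simp
  ultimately show ?thesis
    using B(1) by (intro exI[of _ "mball p \<delta>"] exI[of _ B]) simp
qed

lemma smooth_le_distance:
  assumes d: "manifold_distance A d" and g: "g \<in> smooth_functions A"
    and Z: "\<And>z. z \<in> Z \<Longrightarrow> g z = 0" and "compact K"
  shows "\<exists>C\<ge>0. \<forall>y\<in>K. \<bar>g y\<bar> \<le> C * dist_to_set d y Z"
proof -
  obtain N C where N: "\<And>p. open (N p)" "\<And>p. p \<in> N p" and C: "\<And>p. C p > 0"
    "\<And>p y. y \<in> N p \<Longrightarrow> \<bar>g y\<bar> \<le> C p * dist_to_set d y Z"
    using smooth_le_distance_locally[OF d g Z] by metis
  have "K \<subseteq> (\<Union>p\<in>K. N p)" using N(2) by blast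
  then obtain I where I: "finite I" "K \<subseteq> (\<Union>p\<in>I. N p)"
    by (rule compactE_image[OF \<open>compact K\<close> N(1)])
  have "\<bar>g y\<bar> \<le> (\<Sum>p\<in>I. C p) * dist_to_set d y Z" if y: "y \<in> K" for y
  proof -
    obtain p where p: "p \<in> I" "y \<in> N p" using I(2) y by blast
    have "C p \<le> (\<Sum>p\<in>I. C p)"
      using I(1) p(1) C(1) by (intro member_le_sum) (auto intro: less_imp_le)
    then have "C p * dist_to_set d y Z \<le> (\<Sum>p\<in>I. C p) * dist_to_set d y Z"
      by (rule mult_right_mono[OF _ dist_to_set_nonneg[OF d]])
    with C(2)[OF p(2)] show ?thesis by linarith
  qed
  moreover have "0 \<le> (\<Sum>p\<in>I. C p)" using C(1) by (simp add: sum_nonneg less_imp_le)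
  ultimately show ?thesis by blast
qed

section \<open>The smooth compact-open topology\<close>

text \<open>
  An empty compact set imposes no condition, so every smooth function lies in a member of the subbase.
\<close>
lemma topspace_smooth_topology: "topspace (smooth_topology A) = smooth_functions A"
proof -
  obtain U \<phi> where U: "(U, \<phi>) \<in> A"
    using charts_cover by fastforce
  have "f \<in> topspace (smooth_topology A)" if f: "f \<in> smooth_functions A" for f
  proof -
    have "smooth_functions A = {g \<in> smooth_functions A. \<forall>x\<in>{}.
        \<bar>iterated_deriv [] ((\<lambda>y. g y - f y) \<circ> inv_into U \<phi>) (\<phi> x)\<bar> < 1}"
      by simp
    with U f show ?thesis
      unfolding smooth_topology_def topology_generated_by_topspace
      by (intro UnionI[of "smooth_functions A"] CollectI exI[of _ f] exI[of _ U] exI[of _ \<phi>]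
          exI[of _ "{}"] exI[of _ "[]"] exI[of _ 1]) simp_all
  qed
  moreover have "topspace (smooth_topology A) \<subseteq> smooth_functions A"
    unfolding smooth_topology_def topology_generated_by_topspace by auto
  ultimately show ?thesis by blast
qed

text \<open>
  A basic open set of functions restricts finitely many derivatives on finitely many compact sets, so
  membership of \<open>h\<close> is guaranteed once \<open>h\<close> agrees with \<open>g\<close> near their union \<open>K\<close>.  Taking for \<open>h\<close> the
  product of \<open>g\<close> with a cutoff that is 1 near \<open>K\<close> yields approximation by compactly supported functions, without an exhaustion of
  the manifold.
\<close>
lemma smooth_topology_open_germ:
  assumes "openin (smooth_topology A) S" "g \<in> S"
  shows "\<exists>K. compact K \<and> (\<forall>h\<in>smooth_functions A. \<forall>N. open N \<and> K \<subseteq> N \<and> (\<forall>x\<in>N. h x = g x) \<longrightarrow> h \<in> S)"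
  using assms unfolding smooth_topology_def openin_topology_generated_by_iff
proof (induction S rule: generate_topology_on.induct)
  case Empty
  then show ?case by simp
next
  case (Int a b)
  obtain K where K: "compact K" "\<forall>h\<in>smooth_functions A. \<forall>N. open N \<and> K \<subseteq> N \<and> (\<forall>x\<in>N. h x = g x) \<longrightarrow> h \<in> a"
    using Int.IH(1) Int.prems by auto
  obtain K' where K': "compact K'" "\<forall>h\<in>smooth_functions A. \<forall>N. open N \<and> K' \<subseteq> N \<and> (\<forall>x\<in>N. h x = g x) \<longrightarrow> h \<in> b"
    using Int.IH(2) Int.prems by auto
  show ?case
    using K K' by (intro exI[of _ "K \<union> K'"]) (simp add: compact_Un, blast)
next
  case (UN \<S>)
  from UN.prems obtain S where S: "S \<in> \<S>" "g \<in> S" by blast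
  from UN.IH[OF this] show ?case using S(1) by (meson UnionI)
next
  case (Basis S)
  then obtain f U \<phi> K vs \<epsilon> where U: "(U, \<phi>) \<in> A" and K: "compact K" "K \<subseteq> U"
    and S: "S = {g \<in> smooth_functions A. \<forall>x\<in>K.
         \<bar>iterated_deriv vs ((\<lambda>y. g y - f y) \<circ> inv_into U \<phi>) (\<phi> x)\<bar> < \<epsilon>}"
    by auto
  have "h \<in> S" if h: "h \<in> smooth_functions A" and N: "open N" "K \<subseteq> N" "\<forall>x\<in>N. h x = g x" for h N
  proof -
    have op: "open (\<phi> ` (U \<inter> N))"
      using chart_open[OF U] N(1) by (intro chart_open_map[OF U]) auto
    have "iterated_deriv vs ((\<lambda>y. h y - f y) \<circ> inv_into U \<phi>) (\<phi> x)
        = iterated_deriv vs ((\<lambda>y. g y - f y) \<circ> inv_into U \<phi>) (\<phi> x)" if "x \<in> K" for x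
      using that K(2) N(2,3) by (intro iterated_deriv_cong_open[OF op]) (auto simp: chart_inverse[OF U])
    with h \<open>g \<in> S\<close> show ?thesis by (simp add: S)
  qed
  with K(1) show ?case by blast
qed

section \<open>Ideals of smooth functions\<close>

text \<open>
  Evaluation at a point \<open>x\<close> is continuous: it is the derivative of order zero on the compact set \<open>{x}\<close>.
\<close>
lemma closedin_vanishing_ideal: "closedin (smooth_topology A) (vanishing_ideal A X)"
  unfolding closedin_def topspace_smooth_topology
proof
  show "openin (smooth_topology A) (smooth_functions A - vanishing_ideal A X)"
  proof (subst openin_subopen, rule ballI)
    fix h assume h: "h \<in> smooth_functions A - vanishing_ideal A X"
    then obtain x where x: "x \<in> X" "h x \<noteq> 0" by (auto simp: vanishing_ideal_def)
    obtain U \<phi> where U: "(U, \<phi>) \<in> A" "x \<in> U" by (rule chart_at)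
    define S where "S = {g \<in> smooth_functions A. \<forall>y\<in>{x}.
        \<bar>iterated_deriv [] ((\<lambda>y. g y - h y) \<circ> inv_into U \<phi>) (\<phi> y)\<bar> < \<bar>h x\<bar>}"
    have S: "S = {g \<in> smooth_functions A. \<bar>g x - h x\<bar> < \<bar>h x\<bar>}"
      using chart_inverse[OF U] by (simp add: S_def)
    have "openin (smooth_topology A) S"
      unfolding smooth_topology_def S_def using h U x(2)
      by (intro topology_generated_by_Basis CollectI exI[of _ h] exI[of _ U] exI[of _ \<phi>]
          exI[of _ "{x}"] exI[of _ "[]"] exI[of _ "\<bar>h x\<bar>"]) simp_all
    moreover have "h \<in> S" using h x(2) by (simp add: S)
    moreover have "S \<subseteq> smooth_functions A - vanishing_ideal A X"
      using x by (auto simp: S vanishing_ideal_def)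
    ultimately show "\<exists>T. openin (smooth_topology A) T \<and> h \<in> T \<and> T \<subseteq> smooth_functions A - vanishing_ideal A X"
      by blast
  qed
qed (auto simp: vanishing_ideal_def)

lemma convex_ideal_vanishing_ideal: "convex_ideal A (vanishing_ideal A X)"
  unfolding convex_ideal_def
proof (intro ballI impI)
  fix g assume g: "g \<in> smooth_functions A" "\<exists>f\<in>vanishing_ideal A X. \<forall>x. \<bar>g x\<bar> \<le> f x"
  then obtain f where f: "f \<in> vanishing_ideal A X" "\<And>x. \<bar>g x\<bar> \<le> f x" by blast
  have "g x = 0" if "x \<in> X" for x
    using f(2)[of x] f(1) that by (simp add: vanishing_ideal_def)
  with g(1) show "g \<in> vanishing_ideal A X" by (simp add: vanishing_ideal_def)
qed

lemma radical_ideal_vanishing_ideal: "radical_ideal A (vanishing_ideal A X)"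
  by (simp add: radical_ideal_def vanishing_ideal_def)

text \<open>
  On the support \<open>L\<close> the function \<open>g\<close> is bounded by a multiple of the distance to the zero set, and
  a power of this distance by a multiple of \<open>\<bar>f\<bar>\<close>.  Hence $|g|^m \le B |f|$ on \<open>L\<close>, and trivially
  elsewhere.  Squaring removes the absolute values, which need not be smooth: $g^{2m} \le B^2 f^2$,
  with the right side in the ideal.  Convexity and radicality finish the argument.
\<close>
lemma compactly_supported_mem_lojasiewicz_ideal:
  assumes d: "manifold_distance A d" and loj: "lojasiewicz_ideal A d \<aa>"
    and convex: "convex_ideal A \<aa>" and radical: "radical_ideal A \<aa>"
    and g: "g \<in> vanishing_ideal A (zero_set \<aa>)"
    and L: "compact L" "\<And>x. x \<notin> L \<Longrightarrow> g x = 0"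
  shows "g \<in> \<aa>"
proof -
  let ?\<delta> = "\<lambda>x. dist_to_set d x (zero_set \<aa>)"
  interpret ideal \<aa> "smooth_ring A"
    using loj by (simp add: lojasiewicz_ideal_def)
  have gs: "g \<in> smooth_functions A" and gZ: "\<And>z. z \<in> zero_set \<aa> \<Longrightarrow> g z = 0"
    using g by (auto simp: vanishing_ideal_def)
  obtain f c m where f: "f \<in> \<aa>" "c > 0" "m \<ge> 1"
    and fL: "\<And>x. x \<in> L \<Longrightarrow> c * ?\<delta> x ^ m \<le> \<bar>f x\<bar>"
    using loj L(1) unfolding lojasiewicz_ideal_def by (metis subsetD)
  obtain C where C: "C \<ge> 0" "\<And>y. y \<in> L \<Longrightarrow> \<bar>g y\<bar> \<le> C * ?\<delta> y"
    using smooth_le_distance[OF d gs gZ L(1)] by metis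
  define B where "B = C ^ m / c"
  have gm: "\<bar>g x\<bar> ^ m \<le> B * \<bar>f x\<bar>" for x
  proof (cases "x \<in> L")
    case True
    have "\<bar>g x\<bar> ^ m \<le> (C * ?\<delta> x) ^ m"
      by (rule power_mono[OF C(2)[OF True]]) simp
    also have "\<dots> = B * (c * ?\<delta> x ^ m)"
      using f(2) by (simp add: B_def power_mult_distrib)
    also have "\<dots> \<le> B * \<bar>f x\<bar>"
      using f(2) C(1) by (intro mult_left_mono fL[OF True]) (simp add: B_def)
    finally show ?thesis .
  next
    case False
    then have "\<bar>g x\<bar> ^ m = 0" using L(2) f(3) by simp
    also have "0 \<le> B * \<bar>f x\<bar>" using f(2) C(1) by (simp add: B_def)
    finally show ?thesis .
  qed
  have "(\<lambda>x. (B\<^sup>2 * f x) * f x) \<in> \<aa>"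
  proof -
    have "f \<in> smooth_functions A"
      using f(1) a_subset by (auto simp: smooth_ring_def)
    then have "(\<lambda>x. B\<^sup>2 * f x) \<in> smooth_functions A"
      by (intro smooth_mult smooth_const)
    with I_l_closed[OF f(1), of "\<lambda>x. B\<^sup>2 * f x"] show ?thesis
      by (simp add: smooth_ring_def)
  qed
  moreover have "\<bar>g x ^ (2 * m)\<bar> \<le> (B\<^sup>2 * f x) * f x" for x
  proof -
    have "\<bar>g x ^ (2 * m)\<bar> = (\<bar>g x\<bar> ^ m)\<^sup>2"
      by (simp add: power_abs power_mult[symmetric] mult.commute)
    also have "\<dots> \<le> (B * \<bar>f x\<bar>)\<^sup>2"
      by (rule power_mono[OF gm]) simp
    also have "\<dots> = (B\<^sup>2 * f x) * f x"
      by (simp add: power_mult_distrib) (simp add: power2_eq_square)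
    finally show ?thesis .
  qed
  moreover have "(\<lambda>x. g x ^ (2 * m)) \<in> smooth_functions A"
    using smooth_prod[of "{..<2 * m}" "\<lambda>_. g"] gs by simp
  ultimately have "(\<lambda>x. g x ^ (2 * m)) \<in> \<aa>"
    using convex[unfolded convex_ideal_def, rule_format, of "\<lambda>x. g x ^ (2 * m)"] by fastforce
  then show ?thesis
    using radical[unfolded radical_ideal_def, rule_format, OF gs, of "2 * m"] f(3) by simp
qed

end

theorem theorem1:
  fixes A :: "('a::{t2_space, second_countable_topology}, 'e::real_inner) chart set"
    and d :: "'a \<Rightarrow> 'a \<Rightarrow> real"
    and \<aa> :: "('a \<Rightarrow> real) set"
  assumes "smooth_manifold A"
    and "manifold_distance A d"
    and "lojasiewicz_ideal A d \<aa>"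
  shows "zero_property A \<aa> \<longleftrightarrow>
    closedin (smooth_topology A) \<aa> \<and> convex_ideal A \<aa> \<and> radical_ideal A \<aa>"
proof -
  interpret smooth_manifold A by (rule assms(1))
  let ?I = "vanishing_ideal A (zero_set \<aa>)"
  show ?thesis
  proof
    assume "zero_property A \<aa>"
    then have eq: "\<aa> = ?I" by (simp add: zero_property_def)
    have "closedin (smooth_topology A) ?I"
      by (rule closedin_vanishing_ideal)
    moreover have "convex_ideal A ?I"
      by (rule convex_ideal_vanishing_ideal)
    moreover have "radical_ideal A ?I"
      by (rule radical_ideal_vanishing_ideal)
    ultimately show "closedin (smooth_topology A) \<aa> \<and> convex_ideal A \<aa> \<and> radical_ideal A \<aa>"
      using eq by simp
  next
    assume a: "closedin (smooth_topology A) \<aa> \<and> convex_ideal A \<aa> \<and> radical_ideal A \<aa>"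
    have "\<aa> \<subseteq> smooth_functions A"
      using a closedin_subset topspace_smooth_topology by blast
    then have "\<aa> \<subseteq> ?I" by (auto simp: vanishing_ideal_def zero_set_def)
    moreover have "g \<in> \<aa>" if g: "g \<in> ?I" for g
    proof (rule ccontr)
      assume "g \<notin> \<aa>"
      with g have "g \<in> smooth_functions A - \<aa>" by (simp add: vanishing_ideal_def)
      moreover have "openin (smooth_topology A) (smooth_functions A - \<aa>)"
        using a by (simp add: closedin_def topspace_smooth_topology)
      ultimately obtain K where K: "compact K"
        "\<And>h N. h \<in> smooth_functions A \<Longrightarrow> open N \<Longrightarrow> K \<subseteq> N \<Longrightarrow> \<forall>x\<in>N. h x = g x \<Longrightarrow>
          h \<in> smooth_functions A - \<aa>"
        using smooth_topology_open_germ by metis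
      obtain \<theta> N L where \<theta>: "\<theta> \<in> smooth_functions A" "open N" "K \<subseteq> N" "compact L"
        "\<And>x. x \<in> N \<Longrightarrow> \<theta> x = 1" "\<And>x. x \<notin> L \<Longrightarrow> \<theta> x = 0"
        using smooth_cutoff[OF K(1)] by metis
      \<comment> \<open>The cut-off function lies in the ideal, yet it agrees with \<open>g\<close> near \<open>K\<close>.\<close>
      let ?h = "\<lambda>x. \<theta> x * g x"
      have "?h \<in> smooth_functions A"
        using \<theta>(1) g by (intro smooth_mult) (auto simp: vanishing_ideal_def)
      moreover from this have "?h \<in> ?I"
        using g by (simp add: vanishing_ideal_def)
      then have "?h \<in> \<aa>"
        using a \<theta>(4,6) assms(2,3) by (intro compactly_supported_mem_lojasiewicz_ideal[of d \<aa> _ L]) auto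
      ultimately show False
        using K(2)[of ?h N] \<theta>(2,3,5) by simp
    qed
    ultimately show "zero_property A \<aa>"
      unfolding zero_property_def by blast
  qed
qed

end
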